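(* Let $\mathcal{P}_2(z)=\sum_{n\ge 0} |\mathcal{S}_n\cap Av(\mathbf{4123},\mathbf{1243})|\, z^n$ be the generating function for the permutation class $Av(\mathbf{4123},\mathbf{1243})$. Then $$\mathcal{P}_2(z) = \frac{2-8z+2z^2+17z^3-15z^4+4z^5-(2-10z+16z^2-9z^3+2z^4)\sqrt{1-6z+5z^2}}{2z(2-z)^2(1-2z)(1-3z+z^2)}.$$
   Context: A permutation $\sigma$ contains a pattern $\pi$ if some subsequence of $\sigma$ is order-isomorphic to $\pi$; otherwise $\sigma$ avoids $\pi$. For a set $B$ of patterns, $Av(B)$ is the set of permutations avoiding every element of $B$, and $\mathcal{S}_n$ is the set of permutations of length $n$ (the empty permutation is counted for $n=0$). *)

theory Defs
  imports
    Complex_Main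
    "HOL-Library.Sublist"
    "HOL-Combinatorics.Multiset_Permutations"
    "HOL-Computational_Algebra.Formal_Power_Series"
begin

text \<open>Permutations and patterns are lists in one-line notation.\<close>

definition perms_of_length :: "nat \<Rightarrow> nat list set" where
  "perms_of_length n = permutations_of_set {1..n}"

definition order_isomorphic :: "nat list \<Rightarrow> nat list \<Rightarrow> bool" where
  "order_isomorphic xs ys \<longleftrightarrow> length xs = length ys \<and>
     (\<forall>i<length xs. \<forall>j<length xs. xs ! i < xs ! j \<longleftrightarrow> ys ! i < ys ! j)"

text \<open>The subsequence relation of the library allows non-contiguous positions.\<close>

definition contains_pattern :: "nat list \<Rightarrow> nat list \<Rightarrow> bool" where
  "contains_pattern \<sigma> \<pi> \<longleftrightarrow> (\<exists>\<tau>. subseq \<tau> \<sigma> \<and> order_isomorphic \<tau> \<pi>)"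

definition Av :: "nat list set \<Rightarrow> nat list set" where
  "Av B = {\<sigma>. (\<exists>n. \<sigma> \<in> perms_of_length n) \<and> (\<forall>\<pi>\<in>B. \<not> contains_pattern \<sigma> \<pi>)}"

definition class_gf :: "nat list set \<Rightarrow> real fps" where
  "class_gf C = Abs_fps (\<lambda>n. of_nat (card (perms_of_length n \<inter> C)))"

text \<open>
  The square root of a formal power series with positive constant coefficient: the series whose
  square is the given one and whose constant coefficient is the positive real square root.
\<close>

definition fps_sqrt :: "real fps \<Rightarrow> real fps" where
  "fps_sqrt f = fps_radical root 2 f"

end

theory Submission
  imports Defs
begin

text \<open>
  Permutations of the class are generated by inserting a new maximum.  Deleting the maximum from
  4123 or 1243 leaves 123, so a site is available precisely when every occurrence \<open>a b c\<close> of 123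
  either ends before the site or has the site between \<open>a\<close> and \<open>b\<close>.  Hence only three kinds of
  permutations have to be distinguished, according to the first two maximal decreasing runs
  \<open>[0, d)\<close> and \<open>[d, e)\<close>: all sites are available (123-avoiders); the site \<open>d\<close> is
  available and none to its left; all available sites lie to the right of \<open>e\<close>.  In each case the
  generating function of the descendants depends on a few numbers only, and the recursive equations
  are linear with power-series coefficients.  They determine the solution uniquely, so it suffices
  to exhibit one.  It consists of geometric terms in \<open>1 / (1 - z)\<close> and in the power-series root
  \<open>\<lambda>\<close> of the kernel equation \<open>z \<lambda>\<^sup>2 - \<lambda> + 1 / (1 - z) = 0\<close>,
  whose discriminant is \<open>(1 - 5 z) / (1 - z)\<close>.
\<close>

section \<open>Insertion of a new maximum\<close>

definition occ123 :: "nat list \<Rightarrow> nat \<Rightarrow> nat \<Rightarrow> nat \<Rightarrow> bool" where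
  "occ123 p a b c \<longleftrightarrow> a < b \<and> b < c \<and> c < length p \<and> p ! a < p ! b \<and> p ! b < p ! c"

text \<open>Site \<open>s\<close> is the gap in front of position \<open>s\<close>; site \<open>length p\<close> is at the end.\<close>

definition active_sites :: "nat list \<Rightarrow> nat set" where
  "active_sites p = {s. s \<le> length p \<and> (\<forall>a b c. occ123 p a b c \<longrightarrow> s \<le> c \<longrightarrow> a < s \<and> s \<le> b)}"

definition insert_max :: "nat list \<Rightarrow> nat \<Rightarrow> nat list" where
  "insert_max p s = take s p @ Suc (length p) # drop s p"

text \<open>Makes the inserted \<open>Suc (length p)\<close> a strict maximum and is inherited by
  \<open>insert_max\<close>, so inductions over insertions can carry it.\<close>

definition bounded_entries :: "nat list \<Rightarrow> bool" where
  "bounded_entries p \<longleftrightarrow> (\<forall>x\<in>set p. x \<le> length p)"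

text \<open>Position, after an insertion at \<open>s\<close>, of the entry formerly at
  \<open>i\<close>; only the position \<open>s\<close> of the new entry is not of this form.\<close>

definition shift :: "nat \<Rightarrow> nat \<Rightarrow> nat" where
  "shift s i = (if i < s then i else Suc i)"

section \<open>Positions and entries after an insertion\<close>

lemma active_sites_subset: "active_sites p \<subseteq> {..length p}"
  by (auto simp: active_sites_def)

lemma finite_active_sites [simp]: "finite (active_sites p)"
  using active_sites_subset finite_subset by blast

lemma length_insert_max [simp]: "s \<le> length p \<Longrightarrow> length (insert_max p s) = Suc (length p)"
  by (simp add: insert_max_def)

lemma set_insert_max: "set (insert_max p s) = insert (Suc (length p)) (set p)"
  by (metis append_take_drop_id insert_max_def set_append list.simps(15) Un_insert_right)

lemma bounded_insert_max: "bounded_entries p \<Longrightarrow> s \<le> length p \<Longrightarrow> bounded_entries (insert_max p s)"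
  by (auto simp: bounded_entries_def set_insert_max)

lemma nth_insert_max:
  "s \<le> length p \<Longrightarrow> i \<le> length p \<Longrightarrow>
   insert_max p s ! i = (if i < s then p ! i else if i = s then Suc (length p) else p ! (i - 1))"
  by (auto simp: insert_max_def nth_append nth_Cons')

lemma nth_insert_max_shift: "s \<le> length p \<Longrightarrow> i < length p \<Longrightarrow> insert_max p s ! shift s i = p ! i"
  by (auto simp: shift_def nth_insert_max)

lemma nth_insert_max_self: "s \<le> length p \<Longrightarrow> insert_max p s ! s = Suc (length p)"
  by (simp add: nth_insert_max)

lemma shift_less [simp]: "shift s i < shift s j \<longleftrightarrow> i < j"
  by (auto simp: shift_def)

lemma shift_surj: "i \<noteq> s \<Longrightarrow> \<exists>j. i = shift s j"
  by (rule exI[of _ "if i < s then i else i - 1"]) (auto simp: shift_def)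

lemma shift_less_Suc: "s \<le> n \<Longrightarrow> shift s i < Suc n \<longleftrightarrow> i < n"
  by (auto simp: shift_def)

lemma boundedD: "bounded_entries p \<Longrightarrow> i < length p \<Longrightarrow> p ! i \<le> length p"
  by (simp add: bounded_entries_def)

text \<open>A maximum can only be the last entry of a 123, so each new occurrence is an ascent
  before \<open>s\<close> completed by the new entry.\<close>

lemma occ123_insert_max:
  assumes "bounded_entries p" "s \<le> length p"
  shows "occ123 (insert_max p s) a b c \<longleftrightarrow>
    (\<exists>a' b' c'. occ123 p a' b' c' \<and> a = shift s a' \<and> b = shift s b' \<and> c = shift s c') \<or>
    (c = s \<and> a < b \<and> b < s \<and> p ! a < p ! b)" (is "?l \<longleftrightarrow> ?r")
proof
  assume ?l
  then have l: "a < b" "b < c" "c < Suc (length p)" "insert_max p s ! a < insert_max p s ! b"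
      "insert_max p s ! b < insert_max p s ! c"
    using assms by (auto simp: occ123_def)
  have le: "insert_max p s ! i \<le> Suc (length p)" if "i < Suc (length p)" for i
    using that bounded_insert_max[OF assms] boundedD[of "insert_max p s" i] assms by simp
  have "a \<noteq> s" using l le[of b] assms nth_insert_max_self[of s p] by auto
  moreover have "b \<noteq> s" using l le[of c] assms nth_insert_max_self[of s p] by auto
  ultimately obtain a' b' where ab: "a = shift s a'" "b = shift s b'" by (metis shift_surj)
  show ?r
  proof (cases "c = s")
    case True
    then have "p ! a < p ! b" using l assms by (simp add: nth_insert_max)
    then show ?thesis using True l by auto
  next
    case False
    then obtain c' where c: "c = shift s c'" by (metis shift_surj)
    have "c' < length p" "a' < b'" "b' < c'" using l ab c assms by (auto simp: shift_less_Suc)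
    then have "occ123 p a' b' c'"
      using l ab c assms by (simp add: occ123_def nth_insert_max_shift)
    then show ?thesis using ab c by blast
  qed
next
  assume ?r
  then show ?l
  proof
    assume "c = s \<and> a < b \<and> b < s \<and> p ! a < p ! b"
    then show ?l using assms boundedD[OF assms(1), of b] by (auto simp: occ123_def nth_insert_max)
  next
    assume "\<exists>a' b' c'. occ123 p a' b' c' \<and> a = shift s a' \<and> b = shift s b' \<and> c = shift s c'"
    then show ?l using assms by (auto simp: occ123_def nth_insert_max_shift shift_less_Suc)
  qed
qed

lemma all_occ123_insert_max:
  assumes "bounded_entries p" "s \<le> length p"
  shows "(\<forall>a b c. occ123 (insert_max p s) a b c \<longrightarrow> Q a b c) \<longleftrightarrow>
    (\<forall>a b c. occ123 p a b c \<longrightarrow> Q (shift s a) (shift s b) (shift s c)) \<and>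
    (\<forall>a b. a < b \<and> b < s \<and> p ! a < p ! b \<longrightarrow> Q a b s)"
  unfolding occ123_insert_max[OF assms] by blast

text \<open>Old occurrences constrain a site as before. Those ending in the new maximum concern only
  sites \<open>t \<le> s\<close>, which must separate every ascent before \<open>s\<close>. Site
  \<open>s\<close> itself splits into the candidates \<open>s\<close> and
  \<open>Suc s\<close>.\<close>

lemma active_sites_insert_max:
  assumes "bounded_entries p" "s \<le> length p"
  shows "active_sites (insert_max p s) =
    {t \<in> active_sites p. t \<le> s \<and> (\<forall>a b. a < b \<and> b < s \<and> p ! a < p ! b \<longrightarrow> a < t \<and> t \<le> b)} \<union>
    Suc ` {t \<in> active_sites p. s \<le> t}" (is "_ = ?A \<union> ?B")
proof -
  have *: "t \<in> active_sites (insert_max p s) \<longleftrightarrow> t \<le> Suc (length p) \<and>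
     (\<forall>a b c. occ123 p a b c \<longrightarrow> t \<le> shift s c \<longrightarrow> shift s a < t \<and> t \<le> shift s b) \<and>
     (\<forall>a b. a < b \<and> b < s \<and> p ! a < p ! b \<longrightarrow> t \<le> s \<longrightarrow> a < t \<and> t \<le> b)" for t
    unfolding active_sites_def mem_Collect_eq
    using all_occ123_insert_max[OF assms, of "\<lambda>a b c. t \<le> c \<longrightarrow> a < t \<and> t \<le> b"] assms by simp
  have lo: "t \<in> active_sites (insert_max p s) \<longleftrightarrow> t \<in> ?A" if "t \<le> s" for t
  proof -
    have "t \<le> shift s i \<longleftrightarrow> t \<le> i" "shift s i < t \<longleftrightarrow> i < t" for i
      using that by (auto simp: shift_def)
    then show ?thesis unfolding * using that assms by (auto simp: active_sites_def)
  qed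
  have hi: "Suc t \<in> active_sites (insert_max p s) \<longleftrightarrow> t \<in> active_sites p" if "s \<le> t" for t
  proof -
    have "Suc t \<le> shift s i \<longleftrightarrow> t \<le> i" "shift s i < Suc t \<longleftrightarrow> i < t" for i
      using that by (auto simp: shift_def)
    then show ?thesis unfolding * using that assms by (auto simp: active_sites_def)
  qed
  show ?thesis
  proof (rule set_eqI)
    fix t show "t \<in> active_sites (insert_max p s) \<longleftrightarrow> t \<in> ?A \<union> ?B"
    proof (cases "t \<le> s")
      case True
      then show ?thesis using lo[OF True] by auto
    next
      case False
      then obtain t' where t: "t = Suc t'" "s \<le> t'" by (cases t) auto
      then show ?thesis using hi[of t'] by auto
    qed
  qed
qed

section \<open>The first two decreasing runs under an insertion\<close>

text \<open>If \<open>d = length p\<close> there is no second run and \<open>e = d\<close>.\<close>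

definition desc_runs :: "nat list \<Rightarrow> nat \<Rightarrow> nat \<Rightarrow> bool" where
  "desc_runs p d e \<longleftrightarrow> 1 \<le> d \<and> d \<le> e \<and> e \<le> length p \<and>
    (\<forall>i j. i < j \<longrightarrow> j < d \<longrightarrow> p ! j < p ! i) \<and> (\<forall>i j. d \<le> i \<longrightarrow> i < j \<longrightarrow> j < e \<longrightarrow> p ! j < p ! i) \<and>
    (d < length p \<longrightarrow> p ! (d - 1) < p ! d) \<and> (e < length p \<longrightarrow> d < e \<and> p ! (e - 1) < p ! e)"

lemma desc_runsD:
  assumes "desc_runs p d e"
  shows "1 \<le> d" "d \<le> e" "e \<le> length p" "\<And>i j. i < j \<Longrightarrow> j < d \<Longrightarrow> p ! j < p ! i"
    "\<And>i j. d \<le> i \<Longrightarrow> i < j \<Longrightarrow> j < e \<Longrightarrow> p ! j < p ! i"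
    "d < length p \<Longrightarrow> p ! (d - 1) < p ! d" "e < length p \<Longrightarrow> d < e \<and> p ! (e - 1) < p ! e"
  using assms by (auto simp: desc_runs_def)

lemma desc_runsI:
  assumes "1 \<le> d" "d \<le> e" "e \<le> length p" "\<And>i j. i < j \<Longrightarrow> j < d \<Longrightarrow> p ! j < p ! i"
    "\<And>i j. d \<le> i \<Longrightarrow> i < j \<Longrightarrow> j < e \<Longrightarrow> p ! j < p ! i"
    "d < length p \<Longrightarrow> p ! (d - 1) < p ! d" "e < length p \<Longrightarrow> d < e \<and> p ! (e - 1) < p ! e"
  shows "desc_runs p d e"
  unfolding desc_runs_def using assms by blast

text \<open>No ascent lies inside a run. For \<open>d < s\<close> the ascent from
  \<open>d - 1\<close> to \<open>d\<close> forces \<open>t = d\<close>. This separates all ascents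
  before \<open>s\<close> as long as \<open>s \<le> e\<close>, while for \<open>e < s\<close> the
  ascent from \<open>e - 1\<close> to \<open>e\<close> lies to the right of site
  \<open>d\<close>.\<close>

lemma split_iff:
  assumes "desc_runs p d e" "t \<le> s" "s \<le> length p"
  shows "(\<forall>a b. a < b \<and> b < s \<and> p ! a < p ! b \<longrightarrow> a < t \<and> t \<le> b) \<longleftrightarrow>
    s \<le> d \<or> s \<le> e \<and> t = d" (is "?l \<longleftrightarrow> ?r")
proof
  assume l: ?l
  show ?r
  proof (rule ccontr)
    assume r: "\<not> ?r"
    then have "d < s" by auto
    then have td: "t = d" using l[rule_format, of "d - 1" d] assms by (auto simp: desc_runs_def)
    with r have "e < s" by auto
    then show False using l[rule_format, of "e - 1" e] assms td by (auto simp: desc_runs_def)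
  qed
next
  assume r: ?r
  show ?l
  proof (intro allI impI)
    fix a b assume ab: "a < b \<and> b < s \<and> p ! a < p ! b"
    have "\<not> b < d" using ab desc_runsD(4)[OF assms(1), of a b] by auto
    then have "s \<le> e" "t = d" using r ab by auto
    moreover have "\<not> d \<le> a" using ab desc_runsD(5)[OF assms(1), of a b] \<open>s \<le> e\<close> by auto
    ultimately show "a < t \<and> t \<le> b" using \<open>\<not> b < d\<close> by auto
  qed
qed

lemma active_sites_insert_max_runs:
  assumes "bounded_entries p" "s \<le> length p" "desc_runs p d e"
  shows "active_sites (insert_max p s) =
    {t \<in> active_sites p. t \<le> s \<and> (s \<le> d \<or> s \<le> e \<and> t = d)} \<union> Suc ` {t \<in> active_sites p. s \<le> t}"
  unfolding active_sites_insert_max[OF assms(1,2)] using split_iff[OF assms(3)] assms(2) by auto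

lemma runs_insert_max_0:
  assumes "bounded_entries p" "desc_runs p d e"
  shows "desc_runs (insert_max p 0) (Suc d) (Suc e)"
proof -
  have "insert_max p 0 = Suc (length p) # p" by (simp add: insert_max_def)
  with assms show ?thesis
    by (auto simp: desc_runs_def nth_Cons' bounded_entries_def less_Suc_eq_le)
qed

text \<open>The new maximum ends the first run at \<open>s\<close> and heads what is left of it;
  this second run stops where the first one used to stop.\<close>

lemma runs_insert_max_first:
  assumes "bounded_entries p" "desc_runs p d e" "0 < s" "s < d"
  shows "desc_runs (insert_max p s) s (Suc d)"
proof -
  note r = desc_runsD[OF assms(2)]
  have B: "p ! i < Suc (length p)" if "i < length p" for i
    using boundedD[OF assms(1) that] by simp
  show ?thesis
    by (rule desc_runsI) (use r(1-3) r(4) r(6) B assms(3,4) in \<open>auto simp: nth_insert_max\<close>)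
qed

lemma runs_insert_max_d:
  assumes "bounded_entries p" "desc_runs p d e"
  shows "desc_runs (insert_max p d) d (Suc e)"
proof -
  note r = desc_runsD[OF assms(2)]
  have B: "p ! i < Suc (length p)" if "i < length p" for i
    using boundedD[OF assms(1) that] by simp
  show ?thesis
    by (rule desc_runsI) (use r(1-3) r(4,5) r(7) B in \<open>auto simp: nth_insert_max\<close>)
qed

lemma runs_insert_max_second:
  assumes "bounded_entries p" "desc_runs p d e" "d < s" "s \<le> e"
  shows "desc_runs (insert_max p s) d s"
proof -
  note r = desc_runsD[OF assms(2)]
  have B: "p ! i < Suc (length p)" if "i < length p" for i
    using boundedD[OF assms(1) that] by simp
  show ?thesis
    by (rule desc_runsI) (use r(1-3) r(4,5,6) B assms(3,4) in \<open>auto simp: nth_insert_max\<close>)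
qed

lemma runs_insert_max_late:
  assumes "bounded_entries p" "desc_runs p d e" "e < s" "s \<le> length p"
  shows "desc_runs (insert_max p s) d e"
proof -
  note r = desc_runsD[OF assms(2)]
  show ?thesis
    by (rule desc_runsI) (use r assms(3,4) in \<open>auto simp: nth_insert_max\<close>)
qed

section \<open>Avoidance of 4123 and 1243 under an insertion\<close>

definition avoids_both :: "nat list \<Rightarrow> bool" where
  "avoids_both p \<longleftrightarrow> \<not> (\<exists>a b c d. a < b \<and> b < c \<and> c < d \<and> d < length p \<and>
    (p ! b < p ! c \<and> p ! c < p ! d \<and> p ! d < p ! a \<or> p ! a < p ! b \<and> p ! b < p ! d
        \<and> p ! d < p ! c))"

text \<open>In a forbidden pattern the new maximum plays the 4. The other three entries form a 123
  of \<open>p\<close>, with the maximum in front of it or between its last two entries; availability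
  excludes exactly these two places.\<close>

lemma avoids_both_insert_max:
  assumes "bounded_entries p" "s \<le> length p"
  shows "avoids_both (insert_max p s) \<longleftrightarrow> avoids_both p \<and> s \<in> active_sites p"
proof
  assume g: "avoids_both (insert_max p s)"
  have "avoids_both p"
    unfolding avoids_both_def
  proof (intro notI, elim exE)
    fix a b c d
    assume "a < b \<and> b < c \<and> c < d \<and> d < length p \<and>
      (p ! b < p ! c \<and> p ! c < p ! d \<and> p ! d < p ! a \<or> p ! a < p ! b \<and> p ! b < p ! d
          \<and> p ! d < p ! c)"
    then show False
      using g[unfolded avoids_both_def, simplified, rule_format, of "shift s a" "shift s b"
          "shift s c" "shift s d"] assms
      by (auto simp: nth_insert_max_shift shift_less_Suc)
  qed
  moreover have "s \<in> active_sites p"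
  proof (rule ccontr)
    assume "s \<notin> active_sites p"
    then obtain a b c where o: "occ123 p a b c" "s \<le> c" "s \<le> a \<or> b < s"
      using assms by (auto simp: active_sites_def not_less not_le)
    have B: "p ! c < Suc (length p)" using boundedD[OF assms(1), of c] o by (auto simp: occ123_def)
    show False
    proof (cases "s \<le> a")
      case True
      then have "s < shift s a" by (simp add: shift_def)
      then show False
        using g[unfolded avoids_both_def, simplified, rule_format, of s "shift s a" "shift s b"
            "shift s c"] o B assms
        by (auto simp: nth_insert_max_shift shift_less_Suc occ123_def nth_insert_max_self)
    next
      case False
      then have "shift s b < s" "s < shift s c" using o by (auto simp: shift_def)
      then show False
        using g[unfolded avoids_both_def, simplified, rule_format, of "shift s a"
            "shift s b" s "shift s c"] o B assms
        by (auto simp: nth_insert_max_shift shift_less_Suc occ123_def nth_insert_max_self)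
    qed
  qed
  ultimately show "avoids_both p \<and> s \<in> active_sites p" ..
next
  assume g: "avoids_both p \<and> s \<in> active_sites p"
  have le: "insert_max p s ! i \<le> insert_max p s ! s" if "i < Suc (length p)" for i
    using that bounded_insert_max[OF assms] boundedD[of "insert_max p s" i] assms
        by (simp add: nth_insert_max_self)
  show "avoids_both (insert_max p s)"
    unfolding avoids_both_def
  proof (intro notI, elim exE conjE)
    fix a b c d
    assume lt: "a < b" "b < c" "c < d" "d < length (insert_max p s)"
      and v: "insert_max p s ! b < insert_max p s ! c \<and> insert_max p s ! c < insert_max p s ! d
          \<and> insert_max p s ! d < insert_max p s ! a \<or>
        insert_max p s ! a < insert_max p s ! b \<and> insert_max p s ! b < insert_max p s ! d
            \<and> insert_max p s ! d < insert_max p s ! c"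
    have le': "insert_max p s ! a \<le> insert_max p s ! s" "insert_max p s ! b \<le> insert_max p s ! s"
        "insert_max p s ! c \<le> insert_max p s ! s" "insert_max p s ! d \<le> insert_max p s ! s"
      using lt assms by (auto intro!: le)
    \<comment> \<open>Positions \<open>b\<close> and \<open>d\<close> carry the largest entry of
      neither pattern.\<close>
    have "b \<noteq> s" "d \<noteq> s" using v le' by auto
    then obtain b' d' where bd: "b = shift s b'" "d = shift s d'" by (metis shift_surj)
    have bd': "b' < d'" using lt bd by (metis less_trans shift_less)
    have d': "d' < length p" using lt bd assms by (simp add: shift_less_Suc)
    show False
    proof (cases "a = s \<or> c = s")
      case True
      then show False
      proof
        assume a: "a = s"
        then obtain c' where c: "c = shift s c'" using lt
            by (metis shift_surj less_trans less_irrefl)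
        have "occ123 p b' c' d'"
          using v le' a lt d' bd c assms by (auto simp: occ123_def nth_insert_max_shift)
        moreover have "s \<le> b'" using lt a bd by (auto simp: shift_def split: if_splits)
        ultimately show False using g unfolding active_sites_def occ123_def by fastforce
      next
        assume c: "c = s"
        then obtain a' where a: "a = shift s a'" using lt
            by (metis shift_surj less_trans less_irrefl)
        have "occ123 p a' b' d'"
          using v le' c lt bd' d' bd a assms by (auto simp: occ123_def nth_insert_max_shift)
        moreover have "b' < s" "s \<le> d'" using lt c bd by (auto simp: shift_def split: if_splits)
        ultimately show False using g unfolding active_sites_def by fastforce
      qed
    next
      case False
      then obtain a' c' where ac: "a = shift s a'" "c = shift s c'" by (metis shift_surj)
      have "a' < b'" "b' < c'" "c' < d'" using lt ac bd by auto
      then show False using g[unfolded avoids_both_def] v d' ac bd assms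
          by (auto simp: nth_insert_max_shift)
    qed
  qed
qed

text \<open>The number of nodes \<open>n\<close> levels below \<open>p\<close> in the generating
  tree whose edges are insertions at available sites.\<close>

primrec descendants :: "nat \<Rightarrow> nat list \<Rightarrow> nat" where
  "descendants 0 p = 1"
| "descendants (Suc n) p = (\<Sum>s\<in>active_sites p. descendants n (insert_max p s))"

section \<open>Pattern containment in terms of positions\<close>

lemma subseq_Cons_iff_nth:
  "subseq (x # xs) ys \<longleftrightarrow> (\<exists>i<length ys. ys ! i = x \<and> subseq xs (drop (Suc i) ys))"
proof
  assume "subseq (x # xs) ys"
  then obtain us vs where "ys = us @ x # vs" "subseq xs vs"
    by (auto dest: list_emb_ConsD)
  then show "\<exists>i<length ys. ys ! i = x \<and> subseq xs (drop (Suc i) ys)"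
    by (intro exI[of _ "length us"]) auto
next
  assume "\<exists>i<length ys. ys ! i = x \<and> subseq xs (drop (Suc i) ys)"
  then obtain i where i: "i < length ys" "ys ! i = x" "subseq xs (drop (Suc i) ys)" by blast
  then have "ys = take i ys @ x # drop (Suc i) ys" using id_take_nth_drop by blast
  with i(3) show "subseq (x # xs) ys" by (metis subseq_Cons2 subseq_drop_many)
qed

lemma subseq4_iff:
  "subseq [w, x, y, z] p \<longleftrightarrow> (\<exists>a b c d. a < b \<and> b < c \<and> c < d \<and> d < length p \<and>
    p ! a = w \<and> p ! b = x \<and> p ! c = y \<and> p ! d = z)" (is "?l \<longleftrightarrow> ?r")
proof
  assume ?l
  then obtain a b c d where "a < length p" "b < length p - Suc a" "c < length p - Suc a - Suc b"
      "d < length p - Suc a - Suc b - Suc c" "p ! a = w" "drop (Suc a) p ! b = x"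
      "drop (Suc b) (drop (Suc a) p) ! c = y" "drop (Suc c) (drop (Suc b) (drop (Suc a) p)) ! d = z"
    unfolding subseq_Cons_iff_nth length_drop by blast
  then show ?r
    \<comment> \<open>Each index counts from just behind the previously chosen entry; the sums make
      it absolute.\<close>
    by (intro exI[of _ a] exI[of _ "Suc a + b"] exI[of _ "Suc a + Suc b + c"]
        exI[of _ "Suc a + Suc b + Suc c + d"]) (auto simp: add_ac)
next
  assume ?r
  then obtain a b c d where h: "a < b" "b < c" "c < d" "d < length p" "p ! a = w" "p ! b = x"
      "p ! c = y" "p ! d = z"
    by blast
  have step: "subseq (p ! j # xs) (drop i p)"
      if "i \<le> j" "j < length p" "subseq xs (drop (Suc j) p)" for i j xs
    unfolding subseq_Cons_iff_nth using that by (intro exI[of _ "j - i"]) auto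
  have "subseq [p ! a, p ! b, p ! c, p ! d] (drop 0 p)"
    using h by (intro step) auto
  then show ?l using h by simp
qed

lemma order_isomorphic_4:
  "order_isomorphic t [4,1,2,3] \<longleftrightarrow>
    (\<exists>w x y z. t = [w, x, y, z] \<and> x < y \<and> y < z \<and> z < w)" (is "?l1 \<longleftrightarrow> ?r1")
  "order_isomorphic t [1,2,4,3] \<longleftrightarrow>
    (\<exists>w x y z. t = [w, x, y, z] \<and> w < x \<and> x < z \<and> z < y)" (is "?l2 \<longleftrightarrow> ?r2")
proof -
  have l: "length t = 4 \<longleftrightarrow> (\<exists>w x y z. t = [w, x, y, z])"
    by (auto simp: numeral_eq_Suc length_Suc_conv)
  have "order_isomorphic [w, x, y, z] [4,1,2,3] \<longleftrightarrow> x < y \<and> y < z \<and> z < w"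
    "order_isomorphic [w, x, y, z] [1,2,4,3] \<longleftrightarrow> w < x \<and> x < z \<and> z < y" for w x y z
    unfolding order_isomorphic_def by (simp_all add: numeral_eq_Suc All_less_Suc) auto
  note iso = this
  have "order_isomorphic t q \<Longrightarrow> length t = length q" for q
    by (simp add: order_isomorphic_def)
  from this[of "[4,1,2,3]"] this[of "[1,2,4,3]"] l
  have "order_isomorphic t [4,1,2,3] \<or> order_isomorphic t [1,2,4,3] \<Longrightarrow> \<exists>w x y z. t = [w, x, y, z]"
    by auto
  then show "?l1 \<longleftrightarrow> ?r1" "?l2 \<longleftrightarrow> ?r2"
    using iso by (metis (no_types))+
qed

lemma avoids_both_iff: "avoids_both p \<longleftrightarrow> (\<forall>\<pi>\<in>{[4,1,2,3], [1,2,4,3]}. \<not> contains_pattern p \<pi>)"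
proof -
  have "contains_pattern p [4,1,2,3] \<longleftrightarrow> (\<exists>w x y z. subseq [w, x, y, z] p \<and> x < y \<and> y < z \<and> z < w)"
    "contains_pattern p [1,2,4,3] \<longleftrightarrow> (\<exists>w x y z. subseq [w, x, y, z] p \<and> w < x \<and> x < z \<and> z < y)"
    unfolding contains_pattern_def order_isomorphic_4 by blast+
  moreover have "(\<exists>w x y z. subseq [w, x, y, z] p \<and> P w x y z) \<longleftrightarrow>
      (\<exists>a b c d. a < b \<and> b < c \<and> c < d \<and> d < length p \<and> P (p ! a) (p ! b) (p ! c) (p ! d))" for P
    unfolding subseq4_iff by blast
  moreover have "avoids_both p \<longleftrightarrow>
      \<not> (\<exists>a b c d. a < b \<and> b < c \<and> c < d \<and> d < length p \<and> p ! b < p ! c \<and> p ! c < p ! d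
          \<and> p ! d < p ! a) \<and>
      \<not> (\<exists>a b c d. a < b \<and> b < c \<and> c < d \<and> d < length p \<and> p ! a < p ! b \<and> p ! b < p ! d
          \<and> p ! d < p ! c)"
    unfolding avoids_both_def conj_disj_distribL ex_disj_distrib by simp
  ultimately show ?thesis by simp
qed

section \<open>The generating tree of the class\<close>

lemma perms_iff: "p \<in> perms_of_length n \<longleftrightarrow> distinct p \<and> set p = {1..n}"
  by (auto simp: perms_of_length_def permutations_of_set_def)

lemma perms_length: "p \<in> perms_of_length n \<Longrightarrow> length p = n"
  by (metis perms_iff distinct_card card_atLeastAtMost diff_Suc_1)

lemma perms_bounded: "p \<in> perms_of_length n \<Longrightarrow> bounded_entries p"
  using perms_length[of p n] by (simp add: perms_iff bounded_entries_def)

definition class_perms :: "nat \<Rightarrow> nat list set" where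
  "class_perms n = perms_of_length n \<inter> Av {[4,1,2,3], [1,2,4,3]}"

lemma class_perms_iff: "p \<in> class_perms n \<longleftrightarrow> p \<in> perms_of_length n \<and> avoids_both p"
  by (auto simp: class_perms_def avoids_both_iff Av_def)

lemma finite_class_perms: "finite (class_perms n)"
  unfolding class_perms_def perms_of_length_def by simp

text \<open>Deleting the maximum is the inverse; by \<open>avoids_both_insert_max\<close> it leads
  back to the class and to an available site.\<close>

lemma bij_betw_insert_max: "bij_betw (\<lambda>(p, s). insert_max p s) (SIGMA p:class_perms n. active_sites p) (class_perms (Suc n))"
  unfolding bij_betw_def
proof
  show "inj_on (\<lambda>(p, s). insert_max p s) (SIGMA p:class_perms n. active_sites p)"
  proof (rule inj_onI, clarify)
    fix p s q t
    assume h: "p \<in> class_perms n" "s \<in> active_sites p" "q \<in> class_perms n" "t \<in> active_sites q"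
        "insert_max p s = insert_max q t"
    then have l: "length p = n" "length q = n" "s \<le> n" "t \<le> n" "set p = {1..n}" "set q = {1..n}"
      using active_sites_subset[of p] active_sites_subset[of q] perms_length[of p n] perms_length[of q n]
      by (auto simp: class_perms_iff perms_iff)
    \<comment> \<open>The value \<open>Suc n\<close> marks the cut, being absent from both parts of
      \<open>p\<close>.\<close>
    have "Suc n \<notin> set (take s p)" "Suc n \<notin> set (drop s p)"
      using l set_take_subset[of s p] set_drop_subset[of s p] by auto
    then have eq: "take s p = take t q" "drop s p = drop t q"
      using h(5) l by (auto simp: insert_max_def append_Cons_eq_iff)
    then have "p = q" by (metis append_take_drop_id)
    moreover have "s = t" using arg_cong[OF eq(1), of length] l by simp
    ultimately show "p = q \<and> s = t" by simp
  qed
  show "(\<lambda>(p, s). insert_max p s) ` (SIGMA p:class_perms n. active_sites p) = class_perms (Suc n)"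
  proof (intro equalityI subsetI)
    fix x assume "x \<in> (\<lambda>(p, s). insert_max p s) ` (SIGMA p:class_perms n. active_sites p)"
    then obtain p s where h: "p \<in> class_perms n" "s \<in> active_sites p" "x = insert_max p s" by auto
    then have l: "length p = n" "s \<le> n" "set p = {1..n}"
      "distinct p" "bounded_entries p" "avoids_both p"
      using active_sites_subset[of p] perms_length[of p n] perms_bounded[of p n]
      by (auto simp: class_perms_iff perms_iff)
    have "distinct x"
      using l h(3) set_take_subset[of s p] set_drop_subset[of s p]
      by (auto simp: insert_max_def distinct_take distinct_drop set_take_disj_set_drop_if_distinct)
    moreover have "set x = {1..Suc n}" using l h(3) by (auto simp: set_insert_max)
    moreover have "avoids_both x" using l h avoids_both_insert_max by simp
    ultimately show "x \<in> class_perms (Suc n)" by (simp add: class_perms_iff perms_iff)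
  next
    fix x assume x: "x \<in> class_perms (Suc n)"
    then have "Suc n \<in> set x" by (simp add: class_perms_iff perms_iff)
    then obtain xs ys where xy: "x = xs @ Suc n # ys" by (meson split_list)
    define p where "p = xs @ ys"
    have dx: "distinct x" "set x = {1..Suc n}" using x by (auto simp: class_perms_iff perms_iff)
    have "set p = set x - {Suc n}" using dx(1) by (auto simp: p_def xy)
    then have p: "p \<in> perms_of_length n"
      using dx by (auto simp: perms_iff) (auto simp: p_def xy)
    have x_eq: "x = insert_max p (length xs)" using perms_length[OF p]
        by (simp add: insert_max_def p_def xy)
    have "length xs \<le> length p" by (simp add: p_def)
    then have "avoids_both p" "length xs \<in> active_sites p"
      using x avoids_both_insert_max[OF perms_bounded[OF p]] by (auto simp: x_eq class_perms_iff)
    then show "x \<in> (\<lambda>(p, s). insert_max p s) ` (SIGMA p:class_perms n. active_sites p)"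
      using p x_eq by (intro image_eqI[of _ _ "(p, length xs)"]) (auto simp: class_perms_iff)
  qed
qed

lemma sum_descendants_Suc: "(\<Sum>p\<in>class_perms n. descendants (Suc k) p)
    = (\<Sum>p\<in>class_perms (Suc n). descendants k p)"
proof -
  have "(\<Sum>p\<in>class_perms n. descendants (Suc k) p)
      = (\<Sum>x\<in>(SIGMA p:class_perms n. active_sites p). case x of (p, s) \<Rightarrow> descendants k (insert_max p s))"
    by (simp add: sum.Sigma finite_class_perms)
  also have "\<dots> = (\<Sum>p\<in>class_perms (Suc n). descendants k p)"
    using sum.reindex_bij_betw[OF bij_betw_insert_max, of "descendants k"]
        by (simp add: case_prod_unfold)
  finally show ?thesis .
qed

text \<open>Each step trades one level of descendants for one unit of length. At
  \<open>n = 1\<close> the sum has a single term, which reduces the enumeration to the descendants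
  of \<open>[1]\<close>.\<close>

lemma sum_descendants: "(\<Sum>p\<in>class_perms n. descendants k p) = card (class_perms (n + k))"
proof (induction k arbitrary: n)
  case (Suc k)
  then show ?case using sum_descendants_Suc[of k n] by simp
qed simp

lemma class_perms_eq: "class_perms n = {p \<in> perms_of_length n. avoids_both p}"
  using class_perms_iff by blast

lemma class_perms_0: "class_perms 0 = {[]}"
proof -
  have p: "perms_of_length 0 = {[]}" by (auto simp: perms_iff)
  have "avoids_both []" by (simp add: avoids_both_def)
  then show ?thesis unfolding class_perms_eq p by blast
qed

lemma class_perms_1: "class_perms (Suc 0) = {[1]}"
proof -
  have p: "perms_of_length (Suc 0) = {[1]}" by (simp add: perms_of_length_def)
  have "avoids_both [1]" by (simp add: avoids_both_def)
  then show ?thesis unfolding class_perms_eq p by blast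
qed

section \<open>Solution of the recursive equations\<close>

definition sqrt_disc :: "real fps" where
  "sqrt_disc = fps_sqrt (1 - 6 * fps_X + 5 * fps_X\<^sup>2)"

definition geo :: "real fps" where
  "geo = inverse (1 - fps_X)"

text \<open>The series \<open>1 + z + 2 z^2 + 5 z^3 + 13 z^4 + ...\<close> of alternate Fibonacci
  numbers. Up to one factor \<open>geo\<close> for each site beyond \<open>e\<close>, it counts the
  descendants when \<open>d\<close> is available and no other site up to \<open>e\<close>
  is.\<close>

definition split_coeff :: "real fps" where
  "split_coeff = (1 - 2 * fps_X) * inverse (1 - 3 * fps_X + fps_X\<^sup>2)"

text \<open>
  With \<open>p\<close> available sites in \<open>(d, e]\<close>, this is the solution of
  \<open>w p = 1 + z w (p + 1) + w 0 (u ^ p - 1)\<close> for \<open>u = geo\<close>: a constant plus a multiple of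
  \<open>u ^ p\<close>, where \<open>w 0 = split_coeff\<close> is forced by the case \<open>p = 0\<close>.
\<close>

definition split_wt :: "nat \<Rightarrow> real fps" where
  "split_wt p = (1 - split_coeff) * geo
      + split_coeff * geo ^ p * ((1 - fps_X) * inverse (1 - 2 * fps_X))"

text \<open>Forced by the terms of \<open>full_wt_eq\<close> free of \<open>geo ^ f\<close>: they
  require \<open>full_const * (1 - 2 z) = 1 - split_coeff\<close>.\<close>

definition full_const :: "real fps" where
  "full_const =
    - fps_X * (1 - fps_X) * inverse (1 - 2 * fps_X) * inverse (1 - 3 * fps_X + fps_X\<^sup>2)"

text \<open>Comparing the coefficients of \<open>d\<close> in \<open>full_coeff_rec\<close> gives
  \<open>aff_slope * (2 - z) = z * full_const\<close>; the terms without \<open>d\<close> then give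
  \<open>aff_const\<close>.\<close>

definition aff_slope :: "real fps" where
  "aff_slope = fps_X * full_const * inverse (2 - fps_X)"

definition aff_const :: "real fps" where
  "aff_const = inverse (2 - fps_X) *
    (inverse (2 - fps_X) * full_const * (1 - 2 * fps_X) * (1 - fps_X) + split_coeff - full_const)"

text \<open>
  The quotient \<open>(1 - z - sqrt_disc) / (2 z (1 - z))\<close>: the numerator has constant term \<open>0\<close>,
  so the shift divides it by \<open>z\<close>.
\<close>

definition kernel_root :: "real fps" where
  "kernel_root = fps_shift 1 (geo * (1 - fps_X - sqrt_disc)) * fps_const (1 / 2)"

definition exp_coeff :: "real fps" where
  "exp_coeff = (split_coeff + fps_X * (aff_const + 2 * aff_slope)
      - (aff_const + aff_slope) * (1 - fps_X * geo)) * (1 - fps_X) * inverse (1 - fps_X * kernel_root)"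

text \<open>
  The affine part is the particular solution of the recurrence \<open>full_coeff_rec\<close>;
  \<open>exp_coeff\<close> is fixed by the initial condition \<open>full_coeff_1\<close>.
\<close>

definition full_coeff :: "nat \<Rightarrow> real fps" where
  "full_coeff d = aff_const + of_nat d * aff_slope + exp_coeff * kernel_root ^ d"

text \<open>Weight of a permutation with all sites available: \<open>d\<close> is the length of the
  first run, \<open>f\<close> that of the second, and \<open>g\<close> the number of entries after
  it.\<close>

definition full_wt :: "nat \<Rightarrow> nat \<Rightarrow> nat \<Rightarrow> real fps" where
  "full_wt d f g = geo ^ g * (full_const + geo ^ f * full_coeff d)"

text \<open>With these cleared forms \<open>algebra\<close> can treat each inverse as an
  unknown.\<close>

lemma inverse_relations:
  "geo * (1 - fps_X) = 1"
  "inverse (1 - 2 * fps_X) * (1 - 2 * fps_X) = (1 :: real fps)"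
  "inverse (2 - fps_X) * (2 - fps_X) = (1 :: real fps)"
  "inverse (1 - 3 * fps_X + fps_X\<^sup>2) * (1 - 3 * fps_X + fps_X\<^sup>2) = (1 :: real fps)"
  "inverse (1 - fps_X * kernel_root) * (1 - fps_X * kernel_root) = 1"
  unfolding geo_def by (rule inverse_mult_eq_1; simp)+

section \<open>The square root and the kernel equation\<close>

lemma sqrt_disc_props: "sqrt_disc\<^sup>2 = 1 - 6 * fps_X + 5 * fps_X\<^sup>2" "fps_nth sqrt_disc 0 = 1"
proof -
  have "fps_radical root (Suc 1) (1 - 6 * fps_X + 5 * fps_X\<^sup>2) ^ Suc 1
      = (1 - 6 * fps_X + 5 * fps_X\<^sup>2 :: real fps)"
    by (rule iffD1[OF power_radical]) auto
  then show "sqrt_disc\<^sup>2 = 1 - 6 * fps_X + 5 * fps_X\<^sup>2"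
    by (simp add: sqrt_disc_def fps_sqrt_def numeral_2_eq_2)
  show "fps_nth sqrt_disc 0 = 1"
    by (simp add: sqrt_disc_def fps_sqrt_def)
qed

lemma kernel_root_sqrt: "2 * fps_X * (1 - fps_X) * kernel_root = 1 - fps_X - sqrt_disc"
proof -
  have "fps_X * fps_shift 1 (geo * (1 - fps_X - sqrt_disc)) = geo * (1 - fps_X - sqrt_disc)"
    using sqrt_disc_props(2) by (intro fps_ext) (auto simp: fps_X_mult_nth)
  then have "fps_X * kernel_root * 2 = geo * (1 - fps_X - sqrt_disc)"
    by (simp add: kernel_root_def mult.assoc[symmetric] numeral_fps_const)
  then show ?thesis using inverse_relations(1) by algebra
qed

lemma kernel_root_quadratic: "fps_X * kernel_root\<^sup>2 = kernel_root - geo"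
proof -
  \<comment> \<open>Completing the square leaves
    \<open>sqrt_disc^2 = (1 - z) (1 - 5 z)\<close>.\<close>
  have "4 * fps_X * (1 - fps_X) * (fps_X * (1 - fps_X) * kernel_root\<^sup>2 - (1 - fps_X) * kernel_root + 1) = 0"
    using kernel_root_sqrt sqrt_disc_props(1) by algebra
  then have "fps_X * (1 - fps_X) * kernel_root\<^sup>2 - (1 - fps_X) * kernel_root + 1 = 0"
    using inverse_relations(1) by (simp add: fps_X_neq_zero)
  then show ?thesis using inverse_relations(1) by algebra
qed

text \<open>Telescopes, because \<open>z * geo = geo - 1\<close>.\<close>

lemma geometric: "fps_X * (\<Sum>j=1..n. geo ^ j) = geo ^ n - 1"
proof (induction n)
  case (Suc n)
  have "fps_X * (\<Sum>j=1..Suc n. geo ^ j) = geo ^ n - 1 + fps_X * (geo ^ n * geo)"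
    using Suc by (simp add: distrib_left mult_ac)
  also have "\<dots> = geo ^ n * geo - 1"
  proof -
    have "y - 1 + fps_X * (y * geo) = y * geo - 1" for y
      using inverse_relations(1) by algebra
    then show ?thesis .
  qed
  finally show ?case by (simp add: mult_ac)
qed simp

section \<open>Equations satisfied by the weights\<close>

lemma split_wt_0: "split_wt 0 = split_coeff"
  \<comment> \<open>Clearing denominators leaves
    \<open>(2 - z) (1 - 2 z) - (1 - z)^2 = 1 - 3 z + z^2\<close>, the identity behind the choice of
    \<open>split_coeff\<close>.\<close>
  unfolding split_wt_def split_coeff_def using inverse_relations(1,2,4) by simp algebra

lemma split_wt_eq: "split_wt p = 1 + fps_X * split_wt (Suc p) + split_coeff * (geo ^ p - 1)"
proof -
  \<comment> \<open>\<open>y\<close> abstracts \<open>geo ^ p\<close>, so that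
    \<open>algebra\<close> faces no symbolic exponent.\<close>
  have "(1 - split_coeff) * geo + split_coeff * y * ((1 - fps_X) * inverse (1 - 2 * fps_X)) =
    1 + fps_X * ((1 - split_coeff) * geo
        + split_coeff * (geo * y) * ((1 - fps_X) * inverse (1 - 2 * fps_X)))
            + split_coeff * (y - 1)" for y
    using inverse_relations(1,2) by algebra
  from this[of "geo ^ p"] show ?thesis unfolding split_wt_def power_Suc .
qed

lemma full_const_eq: "full_const * (1 - 2 * fps_X) = 1 - split_coeff"
  unfolding full_const_def split_coeff_def using inverse_relations(2,4) by algebra

text \<open>The case that determines \<open>exp_coeff\<close>: by the kernel equation,
  \<open>kernel_root * (1 - z * geo) - z * kernel_root^2 = geo * (1 - z *
  kernel_root)\<close>.\<close>

lemma full_coeff_1: "full_coeff 1 * (1 - fps_X * geo) = split_coeff + fps_X * full_coeff 2"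
proof -
  have "exp_coeff * geo * (1 - fps_X * kernel_root)
      = split_coeff + fps_X * (aff_const + 2 * aff_slope) - (aff_const + aff_slope) * (1 - fps_X * geo)"
    unfolding exp_coeff_def using inverse_relations(1,5) by algebra
  then show ?thesis unfolding full_coeff_def using kernel_root_quadratic by simp algebra
qed

lemma aff_slope_eq: "aff_slope * (2 - fps_X) = fps_X * full_const"
  unfolding aff_slope_def using inverse_relations(3) by algebra

lemma aff_const_eq: "aff_const * (2 - fps_X) * fps_X
    = aff_slope * (1 - 2 * fps_X) * (1 - fps_X) + fps_X * (split_coeff - full_const)"
  unfolding aff_const_def aff_slope_def using inverse_relations(3) by algebra

text \<open>The homogeneous part has the characteristic equation \<open>z x^2 - x + geo = 0\<close>,
  solved by \<open>kernel_root\<close>; the affine part of \<open>full_coeff\<close> is a particular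
  solution.\<close>

lemma full_coeff_rec:
  "fps_X * full_coeff (Suc (Suc d)) - full_coeff (Suc d) + geo * full_coeff d
     + split_coeff * (1 - geo) + fps_X * full_const * of_nat d - geo * fps_X * full_const * (of_nat d - 1) = 0"
proof -
  have "fps_X * (exp_coeff * kernel_root ^ Suc (Suc d)) - exp_coeff * kernel_root ^ Suc d
      + geo * (exp_coeff * kernel_root ^ d) = 0"
  proof -
    have "fps_X * (exp_coeff * (kernel_root * (kernel_root * y))) - exp_coeff * (kernel_root * y)
        + geo * (exp_coeff * y) = 0" for y
      using kernel_root_quadratic by algebra
    then show ?thesis by simp
  qed
  moreover have "fps_X * (aff_const + (of_nat d + 2) * aff_slope) - (aff_const + (of_nat d + 1) * aff_slope) + geo * (aff_const + of_nat d * aff_slope)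
     + split_coeff * (1 - geo) + fps_X * full_const * of_nat d - geo * fps_X * full_const * (of_nat d - 1) = 0" (is "?l = 0")
  proof -
    \<comment> \<open>The factor \<open>1 - z\<close> removes \<open>geo\<close>, and it is a
      unit.\<close>
    have "?l * (1 - fps_X) = 0"
      using inverse_relations(1) aff_slope_eq aff_const_eq by algebra
    then show ?thesis using inverse_relations(1) by (metis mult_eq_0_iff zero_neq_one)
  qed
  moreover have "fps_X * (x + k2) - (y + k1) + geo * (w + k0) + p + q - r =
      (fps_X * k2 - k1 + geo * k0) + (fps_X * x - y + geo * w + p + q - r)" for x y w k0 k1 k2 p q r
    by (simp add: algebra_simps)
  ultimately show ?thesis unfolding full_coeff_def by (simp only: of_nat_Suc) (simp add: add_ac)
qed

text \<open>Multiplication by \<open>geo\<close> turns the sum for \<open>d\<close> into the sum for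
  \<open>Suc d\<close> without its last term, so the induction step needs only the three-term
  recurrence \<open>full_coeff_rec\<close>.\<close>

lemma full_coeff_eq:
  "full_coeff (Suc d) * (1 - fps_X * geo)
      = split_coeff + fps_X * full_const * of_nat d + fps_X * full_coeff (Suc (Suc d))
     + fps_X * (\<Sum>s=1..d. full_coeff s * geo ^ (d + 2 - s))"
proof (induction d)
  case 0
  then show ?case using full_coeff_1 by (simp add: numeral_2_eq_2)
next
  case (Suc d)
  have "(\<Sum>s=1..Suc d. full_coeff s * geo ^ (Suc d + 2 - s))
      = geo * (\<Sum>s=1..d. full_coeff s * geo ^ (d + 2 - s)) + full_coeff (Suc d) * geo\<^sup>2"
    by (simp add: sum_distrib_left Suc_diff_le power2_eq_square mult_ac)
  then show ?case using Suc full_coeff_rec[of "Suc d"] unfolding of_nat_Suc by algebra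
qed

text \<open>With \<open>x = geo ^ f\<close> and \<open>y = geo ^ g\<close>, the terms in
  \<open>y\<close> alone cancel by \<open>full_const_eq\<close> and those in \<open>x * y\<close> by
  \<open>full_coeff_eq\<close>.\<close>

lemma full_wt_eq:
  "full_wt (Suc d) f g = 1 + fps_X * full_wt (Suc (Suc d)) f g + fps_X * (\<Sum>s=1..d. full_wt s (d + 2 - s) (f + g))
     + fps_X * full_wt (Suc d) (Suc f) g + split_coeff * (geo ^ (f + g) - geo ^ g) + (geo ^ g - 1)"
proof -
  have eq: "y * (full_const + x * full_coeff (Suc d))
      = 1 + fps_X * (y * (full_const + x * full_coeff (Suc (Suc d))))
      + fps_X * (x * y * (of_nat d * full_const + (\<Sum>s=1..d. full_coeff s * geo ^ (d + 2 - s))))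
      + fps_X * (y * (full_const + geo * x * full_coeff (Suc d))) + split_coeff * (x * y - y)
          + (y - 1)" for x y
    using full_coeff_eq[of d] full_const_eq by algebra
  have "(\<Sum>s=1..d. full_wt s (d + 2 - s) (f + g))
      = geo ^ (f + g) * (of_nat d * full_const + (\<Sum>s=1..d. full_coeff s * geo ^ (d + 2 - s)))"
    by (simp add: full_wt_def sum_distrib_left distrib_left sum.distrib mult_ac)
  then show ?thesis
    using eq[of "geo ^ g" "geo ^ f"] by (simp only: full_wt_def power_add power_Suc)
qed

text \<open>The only irrational contribution is \<open>exp_coeff * kernel_root\<close>;
  rationalising its denominator makes it linear in \<open>sqrt_disc\<close>.\<close>

lemma full_wt_closed_form:
  defines "z \<equiv> (fps_X :: real fps)"
  shows "(1 + z * full_wt 1 0 0) * (2 * z * (2 - z)^2 * (1 - 2*z) * (1 - 3*z + z^2)) =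
    (2 - 8*z + 2*z^2 + 17*z^3 - 15*z^4 + 4*z^5
       - (2 - 10*z + 16*z^2 - 9*z^3 + 2*z^4) * sqrt_disc)"
proof -
  \<comment> \<open>The numerator of \<open>exp_coeff\<close>, that is,
    \<open>exp_coeff * (1 - z * kernel_root)\<close>.\<close>
  define R where "R = (split_coeff + z * (aff_const + 2 * aff_slope)) * (1 - z) - (aff_const + aff_slope) * (1 - 2 * z)"
  have c: "split_coeff * (1 - 3*z + z^2) = 1 - 2 * z"
    unfolding split_coeff_def z_def using inverse_relations(4) by algebra
  have full_const: "full_const * (1 - 2*z) * (1 - 3*z + z^2) = - z * (1 - z)"
    unfolding full_const_def z_def using inverse_relations(2,4) by algebra
  have b: "aff_slope * (2 - z) = z * full_const"
    using aff_slope_eq unfolding z_def .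
  have a: "aff_const * (2 - z)^2 = full_const * (1 - 2 * z) * (1 - z)
      + (2 - z) * (split_coeff - full_const)"
    unfolding aff_const_def z_def using inverse_relations(3) by algebra
  have nz: "1 - z \<noteq> 0"
    using inverse_relations(1) unfolding z_def by auto
  have "1 - z + sqrt_disc = 2 * (1 - z) * (1 - z * kernel_root)"
    using kernel_root_sqrt unfolding z_def by algebra
  moreover have "(1 - z * kernel_root) * exp_coeff = R"
  proof -
    have "(1 - z * kernel_root) * exp_coeff
        = (split_coeff + z * (aff_const + 2 * aff_slope) - (aff_const + aff_slope) * (1 - z * geo)) * (1 - z)"
      unfolding exp_coeff_def z_def using inverse_relations(5) by algebra
    also have "\<dots> = R"
      unfolding R_def z_def using inverse_relations(1) by algebra
    finally show ?thesis .
  qed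
  ultimately have "(1 - z + sqrt_disc) * exp_coeff = 2 * (1 - z) * R"
    by algebra
  moreover have sq2: "sqrt_disc\<^sup>2 = (1 - z) * (1 - 5 * z)"
    using sqrt_disc_props(1) unfolding z_def by algebra
  \<comment> \<open>Multiplication by the conjugate:
    \<open>(1 - z)^2 - sqrt_disc^2 = 4 z (1 - z)\<close>.\<close>
  ultimately have "(1 - z) * (4 * z * exp_coeff) = (1 - z) * (2 * R * (1 - z - sqrt_disc))"
    by algebra
  then have zk: "4 * z * exp_coeff = 2 * R * (1 - z - sqrt_disc)"
    using nz by (simp only: mult_cancel_left) simp
  have "(2 * (1 - z)) * (4 * z\<^sup>2 * (exp_coeff * kernel_root))
      = (2 * z * (1 - z) * kernel_root) * (4 * z * exp_coeff)"
    by algebra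
  also have "\<dots> = (1 - z - sqrt_disc) * (2 * R * (1 - z - sqrt_disc))"
    unfolding zk using kernel_root_sqrt unfolding z_def by simp
  also have "\<dots> = 2 * R * ((1 - z)^2 - 2 * (1 - z) * sqrt_disc + sqrt_disc^2)"
    by algebra
  also have "\<dots> = (2 * (1 - z)) * (R * (2 - 6 * z - 2 * sqrt_disc))"
    unfolding sq2 by algebra
  finally have k: "4 * z\<^sup>2 * (exp_coeff * kernel_root) = R * (2 - 6 * z - 2 * sqrt_disc)"
    using nz by (simp only: mult_cancel_left) simp
  have A: "full_wt 1 0 0 = full_const + aff_const + aff_slope + exp_coeff * kernel_root"
    by (simp add: full_wt_def full_coeff_def)
  \<comment> \<open>Multiplied by their denominators, the three constants become polynomials in
    \<open>z\<close>.\<close>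
  define a' b' al' where "a' = aff_const * (2 - z)^2 * (1 - 2*z) * (1 - 3*z + z^2)"
    and "b' = aff_slope * (2 - z) * (1 - 2*z) * (1 - 3*z + z^2)"
    and "al' = full_const * (1 - 2*z) * (1 - 3*z + z^2)"
  have b': "b' = - z\<^sup>2 * (1 - z)"
    unfolding b'_def using b full_const by algebra
  have a': "a' = - z * (1 - z) * (1 - 2 * z) * (1 - z) + (2 - z) * ((1 - 2*z)^2 + z * (1 - z))"
  proof -
    have "a' = (full_const * (1 - 2*z) * (1 - 3*z + z^2)) * (1 - 2*z) * (1 - z) +
      (2 - z) * ((split_coeff * (1 - 3*z + z^2)) * (1 - 2*z) - full_const * (1 - 2*z) * (1 - 3*z + z^2))"
      unfolding a'_def a by algebra
    then show ?thesis unfolding full_const c by algebra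
  qed
  have R: "R * ((2 - z)^2 * (1 - 2*z) * (1 - 3*z + z^2)) =
     ((1 - 2*z)^2 * (2 - z)^2 + z * (a' + 2 * b' * (2 - z))) * (1 - z) - (a' + b' * (2 - z)) * (1 - 2 * z)"
  proof -
    have "R * ((2 - z)^2 * (1 - 2*z) * (1 - 3*z + z^2)) =
      ((split_coeff * (1 - 3*z + z^2)) * (1 - 2*z) * (2 - z)^2 + z * (a' + 2 * b' * (2 - z))) * (1 - z) - (a' + b' * (2 - z)) * (1 - 2 * z)"
      unfolding R_def a'_def b'_def by algebra
    then show ?thesis unfolding c by algebra
  qed
  have "2 * ((1 + z * full_wt 1 0 0) * (2 * z * (2 - z)^2 * (1 - 2*z) * (1 - 3*z + z^2))) =
    4 * z * (2 - z)^2 * (1 - 2*z) * (1 - 3*z + z^2) + 4 * z\<^sup>2 * (al' * (2 - z)^2 + a'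
        + b' * (2 - z)) +
    4 * z\<^sup>2 * (exp_coeff * kernel_root) * ((2 - z)^2 * (1 - 2*z) * (1 - 3*z + z^2))"
    unfolding A a'_def b'_def al'_def by algebra
  also have "\<dots> = 4 * z * (2 - z)^2 * (1 - 2*z) * (1 - 3*z + z^2)
      + 4 * z\<^sup>2 * (- z * (1 - z) * (2 - z)^2 + a' + b' * (2 - z)) +
    (2 - 6 * z - 2 * sqrt_disc) * (((1 - 2*z)^2 * (2 - z)^2 + z * (a' + 2 * b' * (2 - z))) * (1 - z) - (a' + b' * (2 - z)) * (1 - 2 * z))"
    unfolding k al'_def full_const R[symmetric] by algebra
  also have "\<dots> = 2 * (2 - 8*z + 2*z^2 + 17*z^3 - 15*z^4 + 4*z^5
       - (2 - 10*z + 16*z^2 - 9*z^3 + 2*z^4) * sqrt_disc)"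
    unfolding a' b' by algebra
  finally show ?thesis by (simp only: mult_cancel_left) simp
qed

section \<open>Generating functions of descendants\<close>

text \<open>As \<open>s\<close> runs through \<open>S\<close>, the number of elements from
  \<open>s\<close> upwards takes each value from 1 to \<open>card S\<close> once.\<close>

lemma sum_card_upper:
  fixes S :: "nat set" and f :: "nat \<Rightarrow> 'a::comm_monoid_add"
  assumes "finite S"
  shows "(\<Sum>s\<in>S. f (card {t\<in>S. s \<le> t})) = (\<Sum>j=1..card S. f j)"
  using assms
proof (induction rule: finite_linorder_min_induct)
  case (insert b A)
  have "{t \<in> insert b A. b \<le> t} = insert b A" using insert by auto
  moreover have "b \<notin> A" using insert by auto
  moreover have "(\<Sum>s\<in>A. f (card {t \<in> insert b A. s \<le> t})) = (\<Sum>s\<in>A. f (card {t\<in>A. s \<le> t}))"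
    using insert by (intro sum.cong refl arg_cong[where f = "\<lambda>A. f (card A)"]) auto
  ultimately show ?case using insert by (simp add: add.commute)
qed simp

lemma geometric_interval:
  assumes "a \<le> b" "b \<le> n"
  shows "fps_X * (\<Sum>s\<in>{a<..b}. geo ^ (Suc n - s)) = geo ^ (n - a) - geo ^ (n - b)"
  using assms
proof (induction b rule: dec_induct)
  case (step b)
  have "{a<..Suc b} = insert (Suc b) {a<..b}" using step by auto
  moreover have "fps_X * geo ^ (n - b) = geo ^ (n - b) - geo ^ (n - Suc b)"
  proof -
    have "n - b = Suc (n - Suc b)" using step by simp
    moreover have "fps_X * (geo * y) = geo * y - y" for y using inverse_relations(1) by algebra
    ultimately show ?thesis by simp
  qed
  ultimately show ?case using step by (simp add: distrib_left)
qed simp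

text \<open>With \<open>k\<close> available sites, all beyond \<open>e\<close>, an insertion keeps
  both runs and leaves \<open>j\<close> sites, each \<open>j\<close> from 1 to \<open>k\<close>
  occurring once. The equation \<open>w k = 1 + z * (w 1 + ... + w k)\<close> has the solution
  \<open>geo ^ k\<close>.\<close>

lemma descendants_late:
  assumes "bounded_entries p" "desc_runs p d e" "\<forall>t\<in>active_sites p. e < t"
  shows "real (descendants n p) = fps_nth (geo ^ card (active_sites p)) n"
  using assms
proof (induction n arbitrary: p)
  case 0
  then show ?case by (simp add: geo_def fps_nth_power_0)
next
  case (Suc n)
  have "real (descendants n (insert_max p s)) = fps_nth (geo ^ card {t\<in>active_sites p. s \<le> t}) n"
      if s: "s \<in> active_sites p" for s
  proof -
    have l: "s \<le> length p" "e < s" "d \<le> e"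
        using s active_sites_subset Suc.prems(3) desc_runsD[OF Suc.prems(2)] by auto
    have a: "active_sites (insert_max p s) = Suc ` {t\<in>active_sites p. s \<le> t}"
      using active_sites_insert_max_runs[OF Suc.prems(1) l(1) Suc.prems(2)] l by auto
    have "real (descendants n (insert_max p s))
        = fps_nth (geo ^ card (active_sites (insert_max p s))) n"
      using Suc.prems l by (intro Suc.IH bounded_insert_max runs_insert_max_late) (auto simp: a)
    then show ?thesis by (simp add: a card_image)
  qed
  then have "real (descendants (Suc n) p)
      = (\<Sum>s\<in>active_sites p. fps_nth (geo ^ card {t\<in>active_sites p. s \<le> t}) n)"
    by simp
  also have "\<dots> = (\<Sum>j=1..card (active_sites p). fps_nth (geo ^ j) n)"
    by (rule sum_card_upper) simp
  also have "\<dots> = fps_nth (fps_X * (\<Sum>j=1..card (active_sites p). geo ^ j)) (Suc n)"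
    by (simp add: fps_sum_nth)
  finally show ?case unfolding geometric by simp
qed

text \<open>One summand for each kind of insertion, given \<open>k\<close> sites in
  \<open>(d, e]\<close> and \<open>q\<close> beyond \<open>e\<close>: at \<open>d\<close>, in
  \<open>(d, e]\<close>, beyond \<open>e\<close>.\<close>

lemma split_wt_expand: "geo ^ q * split_wt k = 1 + fps_X * (geo ^ q * split_wt (Suc k)
  + (\<Sum>j=1..k. geo ^ (j + q) * split_coeff) + (\<Sum>j=1..q. geo ^ j))"
proof -
  have "(\<Sum>j=1..k. geo ^ (j + q) * split_coeff) = geo ^ q * split_coeff * (\<Sum>j=1..k. geo ^ j)"
    by (simp add: sum_distrib_left power_add mult_ac)
  then have "fps_X * (geo ^ q * split_wt (Suc k) + (\<Sum>j=1..k. geo ^ (j + q) * split_coeff)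
      + (\<Sum>j=1..q. geo ^ j))
    = geo ^ q * (fps_X * split_wt (Suc k)) + geo ^ q * split_coeff * (fps_X * (\<Sum>j=1..k. geo ^ j))
        + fps_X * (\<Sum>j=1..q. geo ^ j)"
    by (simp only: distrib_left mult_ac)
  also have "\<dots> = geo ^ q * split_wt k - 1"
  proof -
    have "v * (fps_X * x) + v * split_coeff * (w - 1) + (v - 1) = v * y - 1"
      if "y = 1 + fps_X * x + split_coeff * (w - 1)" for v w x y :: "real fps"
      using that by algebra
    from this[OF split_wt_eq] show ?thesis unfolding geometric .
  qed
  finally show ?thesis by simp
qed

text \<open>Insertion at \<open>d\<close> adds one site to the second run. Insertion at
  \<open>s\<close> in \<open>(d, e]\<close> keeps \<open>d\<close> but ends the second run at
  \<open>s\<close>, so all other surviving sites lie beyond it. Insertion after \<open>e\<close>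
  loses \<open>d\<close> and leads to \<open>descendants_late\<close>.\<close>

lemma descendants_split:
  assumes "bounded_entries p" "desc_runs p d e" "d \<in> active_sites p" "\<forall>t\<in>active_sites p. d \<le> t"
  shows "real (descendants n p) = fps_nth (geo ^ card {t\<in>active_sites p. e < t} * split_wt (card {t\<in>active_sites p. d < t \<and> t \<le> e})) n"
  using assms
proof (induction n arbitrary: p e)
  case 0
  have "fps_nth (geo ^ q * split_wt k) 0 = 1" for q k using split_wt_expand[of q k] by simp
  then show ?case by simp
next
  case (Suc n)
  define P where "P = {t\<in>active_sites p. d < t \<and> t \<le> e}"
  define Q where "Q = {t\<in>active_sites p. e < t}"
  note r = desc_runsD[OF Suc.prems(2)]
  have le: "s \<le> length p" if "s \<in> active_sites p" for s using that active_sites_subset by auto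
  have fin: "finite P" "finite Q" by (auto simp: P_def Q_def)
  have sites: "active_sites p = insert d (P \<union> Q)" using Suc.prems(3,4) r(2)
      by (force simp: P_def Q_def)
  have disj: "d \<notin> P \<union> Q" "P \<inter> Q = {}" using r(2) by (auto simp: P_def Q_def)
  have "real (descendants n (insert_max p d)) = fps_nth (geo ^ card Q * split_wt (Suc (card P))) n"
  proof -
    \<comment> \<open>Site \<open>d\<close> survives on both sides of the new maximum.\<close>
    have a: "active_sites (insert_max p d) = insert d (Suc ` insert d (P \<union> Q))"
    proof -
      have "{t \<in> active_sites p. d \<le> t} = insert d (P \<union> Q)"
        using Suc.prems(4) sites by blast
      moreover have "{t \<in> active_sites p. t \<le> d \<and> (d \<le> d \<or> d \<le> e \<and> t = d)} = {d}"
        using Suc.prems(3,4) by (auto intro!: antisym)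
      ultimately show ?thesis
        using active_sites_insert_max_runs[OF Suc.prems(1) le[OF Suc.prems(3)] Suc.prems(2)]
            by (simp add: insert_commute)
    qed
    have "{t\<in>active_sites (insert_max p d). Suc e < t}
        = Suc ` Q" "{t\<in>active_sites (insert_max p d). d < t \<and> t \<le> Suc e} = Suc ` insert d P"
      unfolding a using r(2) by (auto simp: P_def Q_def)
    moreover have "real (descendants n (insert_max p d))
        = fps_nth (geo ^ card {t\<in>active_sites (insert_max p d). Suc e < t} *
        split_wt (card {t\<in>active_sites (insert_max p d). d < t \<and> t \<le> Suc e})) n"
    proof (intro Suc.IH bounded_insert_max runs_insert_max_d)
      show "\<forall>t\<in>active_sites (insert_max p d). d \<le> t"
        using Suc.prems(4) unfolding a sites by (auto intro: le_SucI)
    qed (use Suc.prems(1-3) le in \<open>auto simp: a\<close>)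
    moreover have "card (insert d P) = Suc (card P)" using fin(1) disj(1) by simp
    ultimately show ?thesis by (simp only: card_image[OF inj_Suc])
  qed
  moreover have "(\<Sum>s\<in>P. real (descendants n (insert_max p s)))
      = (\<Sum>j=1..card P. fps_nth (geo ^ (j + card Q) * split_coeff) n)"
  proof -
    have "real (descendants n (insert_max p s))
        = fps_nth (geo ^ (card {t\<in>P. s \<le> t} + card Q) * split_coeff) n" if s: "s \<in> P" for s
    proof -
      have s': "s \<in> active_sites p" "d < s" "s \<le> e" using s by (auto simp: P_def)
      have a: "active_sites (insert_max p s) = insert d (Suc ` {t\<in>active_sites p. s \<le> t})"
        using active_sites_insert_max_runs[OF Suc.prems(1) le[OF s'(1)] Suc.prems(2)] s' Suc.prems(3) by auto
      have "{t\<in>active_sites (insert_max p s). s < t}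
          = Suc ` {t\<in>active_sites p. s \<le> t}" "{t\<in>active_sites (insert_max p s). d < t \<and> t \<le> s} = {}"
        unfolding a using s' by auto
      moreover have "real (descendants n (insert_max p s))
          = fps_nth (geo ^ card {t\<in>active_sites (insert_max p s). s < t} *
          split_wt (card {t\<in>active_sites (insert_max p s). d < t \<and> t \<le> s})) n"
        using Suc.prems le s' by (intro Suc.IH bounded_insert_max runs_insert_max_second) (auto simp: a)
      moreover have "{t\<in>active_sites p. s \<le> t} = {t\<in>P. s \<le> t} \<union> Q"
        using s' by (auto simp: P_def Q_def)
      then have "card {t\<in>active_sites p. s \<le> t} = card {t\<in>P. s \<le> t} + card Q"
        using fin disj by (simp add: card_Un_disjoint disjoint_iff)
      ultimately show ?thesis by (simp only: card_image[OF inj_Suc] card.empty split_wt_0)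
    qed
    then have "(\<Sum>s\<in>P. real (descendants n (insert_max p s)))
        = (\<Sum>s\<in>P. fps_nth (geo ^ (card {t\<in>P. s \<le> t} + card Q) * split_coeff) n)"
      by simp
    also have "\<dots> = (\<Sum>j=1..card P. fps_nth (geo ^ (j + card Q) * split_coeff) n)"
      by (rule sum_card_upper[OF fin(1), of "\<lambda>j. fps_nth (geo ^ (j + card Q) * split_coeff) n"])
    finally show ?thesis .
  qed
  moreover have "(\<Sum>s\<in>Q. real (descendants n (insert_max p s)))
      = (\<Sum>j=1..card Q. fps_nth (geo ^ j) n)"
  proof -
    have "real (descendants n (insert_max p s)) = fps_nth (geo ^ card {t\<in>Q. s \<le> t}) n"
        if s: "s \<in> Q" for s
    proof -
      have s': "s \<in> active_sites p" "e < s" using s by (auto simp: Q_def)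
      have a: "active_sites (insert_max p s) = Suc ` {t\<in>Q. s \<le> t}"
        using active_sites_insert_max_runs[OF Suc.prems(1) le[OF s'(1)] Suc.prems(2)] s' r(2)
            by (auto simp: Q_def)
      have "real (descendants n (insert_max p s))
          = fps_nth (geo ^ card (active_sites (insert_max p s))) n"
        using Suc.prems le s' by (intro descendants_late bounded_insert_max runs_insert_max_late) (auto simp: a Q_def)
      then show ?thesis by (simp add: a card_image)
    qed
    then have "(\<Sum>s\<in>Q. real (descendants n (insert_max p s)))
        = (\<Sum>s\<in>Q. fps_nth (geo ^ card {t\<in>Q. s \<le> t}) n)"
      by simp
    also have "\<dots> = (\<Sum>j=1..card Q. fps_nth (geo ^ j) n)"
      by (rule sum_card_upper[OF fin(2)])
    finally show ?thesis .
  qed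
  moreover have "real (descendants (Suc n) p)
      = real (descendants n (insert_max p d)) + (\<Sum>s\<in>P. real (descendants n (insert_max p s)))
          + (\<Sum>s\<in>Q. real (descendants n (insert_max p s)))"
    unfolding descendants.simps sites using fin disj by (simp add: sum.union_disjoint)
  ultimately have "real (descendants (Suc n) p)
      = fps_nth (1 + fps_X * (geo ^ card Q * split_wt (Suc (card P))
      + (\<Sum>j=1..card P. geo ^ (j + card Q) * split_coeff) + (\<Sum>j=1..card Q. geo ^ j))) (Suc n)"
    by (simp add: fps_sum_nth)
  then show ?case unfolding split_wt_expand[symmetric] P_def Q_def .
qed

text \<open>\<open>full_wt_eq\<close> regrouped by the site of insertion: in front, inside the first
  run, at \<open>d\<close>, in the second run, behind it.\<close>

lemma full_wt_expand:
  assumes "1 \<le> d" "d \<le> e" "e \<le> m"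
  shows "full_wt d (e - d) (m - e) = 1 + fps_X * (full_wt (Suc d) (e - d) (m - e)
    + (\<Sum>s=1..<d. full_wt s (Suc d - s) (m - d)) + full_wt d (Suc (e - d)) (m - e)
    + (\<Sum>s\<in>{d<..e}. geo ^ (Suc m - s) * split_coeff) + (\<Sum>s\<in>{e<..m}. geo ^ (Suc m - s)))"
proof -
  obtain d' where d: "d = Suc d'" using assms by (cases d) auto
  have "fps_X * (\<Sum>s\<in>{d<..e}. geo ^ (Suc m - s) * split_coeff)
      = split_coeff * (geo ^ (m - d) - geo ^ (m - e))"
  proof -
    have "fps_X * (\<Sum>s\<in>{d<..e}. geo ^ (Suc m - s) * split_coeff)
        = (fps_X * (\<Sum>s\<in>{d<..e}. geo ^ (Suc m - s))) * split_coeff"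
      by (simp only: sum_distrib_right mult.assoc)
    then show ?thesis using geometric_interval[of d e m] assms by (simp add: mult.commute)
  qed
  moreover have "fps_X * (\<Sum>s\<in>{e<..m}. geo ^ (Suc m - s)) = geo ^ (m - e) - 1"
    using geometric_interval[of e m m] assms by simp
  moreover have "{1..<d} = {1..d'}" "Suc d = d' + 2" by (auto simp: d)
  moreover have "e - d + (m - e) = m - d" using assms by simp
  ultimately show ?thesis
    using full_wt_eq[of d' "e - d" "m - e"] unfolding d by (simp only: distrib_left add_ac)
qed

text \<open>For \<open>s \<le> d\<close> no ascent precedes the new maximum, so all sites stay
  available. For \<open>d < s \<le> e\<close> only \<open>d\<close> survives on the left, and for
  \<open>e < s\<close> nothing does; these cases are \<open>descendants_split\<close> without sites
  in the second run and \<open>descendants_late\<close>.\<close>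

lemma descendants_full:
  assumes "bounded_entries p" "desc_runs p d e" "active_sites p = {..length p}"
  shows "real (descendants n p) = fps_nth (full_wt d (e - d) (length p - e)) n"
  using assms
proof (induction n arbitrary: p d e)
  case 0
  then show ?case using desc_runsD[OF 0(2)] full_wt_expand[of d e "length p"] by simp
next
  case (Suc n)
  note r = desc_runsD[OF Suc.prems(2)]
  let ?m = "length p"
  have ai: "active_sites (insert_max p s) = {t. t \<le> s \<and> (s \<le> d \<or> s \<le> e \<and> t = d)} \<union> Suc ` {s..?m}"
      if "s \<le> ?m" for s
  proof -
    have "{t \<in> {..?m}. s \<le> t} = {s..?m}"
      "{t \<in> {..?m}. t \<le> s \<and> (s \<le> d \<or> s \<le> e \<and> t = d)} = {t. t \<le> s \<and> (s \<le> d \<or> s \<le> e \<and> t = d)}"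
      using that by auto
    then show ?thesis
      using active_sites_insert_max_runs[OF Suc.prems(1) that Suc.prems(2)] unfolding Suc.prems(3) by simp
  qed
  have full: "active_sites (insert_max p s) = {..length (insert_max p s)}" if "s \<le> d" for s
  proof -
    have s: "s \<le> ?m" using that r(2,3) by simp
    have eq: "{t. t \<le> s \<and> (s \<le> d \<or> s \<le> e \<and> t = d)} = {..s}" using that by auto
    show ?thesis unfolding ai[OF s] length_insert_max[OF s] eq using s by auto
  qed
  have IH: "real (descendants n (insert_max p s)) = fps_nth (full_wt d' (e' - d') (Suc ?m - e')) n"
    if "s \<le> d" "desc_runs (insert_max p s) d' e'" for s d' e'
  proof -
    have s: "s \<le> ?m" using that(1) r(2,3) by simp
    show ?thesis
      using Suc.IH[OF bounded_insert_max[OF Suc.prems(1) s] that(2) full[OF that(1)]] unfolding length_insert_max[OF s] .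
  qed
  have n0: "real (descendants n (insert_max p 0)) = fps_nth (full_wt (Suc d) (e - d) (?m - e)) n"
    using IH[OF _ runs_insert_max_0[OF Suc.prems(1,2)]] by simp
  have n1: "real (descendants n (insert_max p s)) = fps_nth (full_wt s (Suc d - s) (?m - d)) n"
      if "s \<in> {1..<d}" for s
    using IH[OF _ runs_insert_max_first[OF Suc.prems(1,2), of s]] that by simp
  have n2: "real (descendants n (insert_max p d)) = fps_nth (full_wt d (Suc (e - d)) (?m - e)) n"
    using IH[OF _ runs_insert_max_d[OF Suc.prems(1,2)]] r(2) by (simp add: Suc_diff_le)
  have n3: "real (descendants n (insert_max p s)) = fps_nth (geo ^ (Suc ?m - s) * split_coeff) n"
      if s: "s \<in> {d<..e}" for s
  proof -
    have s': "s \<le> ?m" using s r(3) by simp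
    have eq: "{t. t \<le> s \<and> (s \<le> d \<or> s \<le> e \<and> t = d)} = {d}" using s by auto
    have a: "active_sites (insert_max p s) = insert d (Suc ` {s..?m})" unfolding ai[OF s'] eq
        by simp
    have "{t\<in>active_sites (insert_max p s). s < t}
        = Suc ` {s..?m}" "{t\<in>active_sites (insert_max p s). d < t \<and> t \<le> s} = {}"
      unfolding a using s by auto
    moreover have "real (descendants n (insert_max p s))
        = fps_nth (geo ^ card {t\<in>active_sites (insert_max p s). s < t} *
        split_wt (card {t\<in>active_sites (insert_max p s). d < t \<and> t \<le> s})) n"
      using Suc.prems s r(3) by (intro descendants_split bounded_insert_max runs_insert_max_second) (auto simp: a)
    ultimately show ?thesis by (simp only: card_image[OF inj_Suc] card_atLeastAtMost card.empty split_wt_0)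
  qed
  have n4: "real (descendants n (insert_max p s)) = fps_nth (geo ^ (Suc ?m - s)) n"
      if s: "s \<in> {e<..?m}" for s
  proof -
    have s': "s \<le> ?m" using s by simp
    have eq: "{t. t \<le> s \<and> (s \<le> d \<or> s \<le> e \<and> t = d)} = {}" using s r(2) by auto
    have a: "active_sites (insert_max p s) = Suc ` {s..?m}" unfolding ai[OF s'] eq by simp
    have "real (descendants n (insert_max p s))
        = fps_nth (geo ^ card (active_sites (insert_max p s))) n"
      using Suc.prems s by (intro descendants_late bounded_insert_max runs_insert_max_late) (auto simp: a)
    then show ?thesis by (simp add: a card_image)
  qed
  \<comment> \<open>The five kinds of site, in the order of \<open>full_wt_expand\<close>.\<close>
  have "{..?m} = insert 0 ({1..<d} \<union> insert d ({d<..e} \<union> {e<..?m}))" using r(1-3) by auto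
  then have "real (descendants (Suc n) p)
      = real (descendants n (insert_max p 0)) + (\<Sum>s=1..<d. real (descendants n (insert_max p s)))
      + real (descendants n (insert_max p d))
          + (\<Sum>s\<in>{d<..e}. real (descendants n (insert_max p s)))
              + (\<Sum>s\<in>{e<..?m}. real (descendants n (insert_max p s)))"
    using r(1-3) by (simp add: Suc.prems(3) sum.union_disjoint disjoint_iff)
  also have "\<dots> = fps_nth (1 + fps_X * (full_wt (Suc d) (e - d) (?m - e)
    + (\<Sum>s=1..<d. full_wt s (Suc d - s) (?m - d)) + full_wt d (Suc (e - d)) (?m - e)
    + (\<Sum>s\<in>{d<..e}. geo ^ (Suc ?m - s) * split_coeff) + (\<Sum>s\<in>{e<..?m}. geo ^ (Suc ?m - s)))) (Suc n)"
    using n0 n1 n2 n3 n4 by (simp add: fps_sum_nth)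
  finally show ?case unfolding full_wt_expand[OF r(1-3), symmetric] .
qed

text \<open>The summand 1 is the empty permutation. All others descend from \<open>[1]\<close>,
  where \<open>d = e = 1\<close> and every site is available; the factor \<open>fps_X\<close>
  accounts for its entry.\<close>

lemma class_gf_eq: "class_gf (Av {[4,1,2,3], [1,2,4,3]}) = 1 + fps_X * full_wt 1 0 0"
proof (rule fps_ext)
  fix n
  have gf: "class_gf (Av {[4,1,2,3], [1,2,4,3]}) = Abs_fps (\<lambda>n. real (card (class_perms n)))"
    by (simp add: class_gf_def class_perms_def)
  show "fps_nth (class_gf (Av {[4,1,2,3], [1,2,4,3]})) n = fps_nth (1 + fps_X * full_wt 1 0 0) n"
  proof (cases n)
    case 0
    then show ?thesis unfolding gf by (simp add: class_perms_0)
  next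
    case (Suc k)
    have "desc_runs [1] 1 1" "bounded_entries [1]" "active_sites [1] = {..length [1::nat]}"
      by (auto simp: desc_runs_def bounded_entries_def active_sites_def occ123_def)
    from descendants_full[OF this(2,1,3)] have "real (descendants k [1])
        = fps_nth (full_wt 1 0 0) k" by simp
    then show ?thesis unfolding gf Suc using sum_descendants[of k 1] by (simp add: class_perms_1)
  qed
qed

theorem theorem1p2:
  defines "z \<equiv> (fps_X :: real fps)"
  shows "class_gf (Av {[4,1,2,3], [1,2,4,3]}) =
    (2 - 8*z + 2*z^2 + 17*z^3 - 15*z^4 + 4*z^5
       - (2 - 10*z + 16*z^2 - 9*z^3 + 2*z^4) * fps_sqrt (1 - 6*z + 5*z^2))
    / (2 * z * (2 - z)^2 * (1 - 2*z) * (1 - 3*z + z^2))"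
proof -
  \<comment> \<open>The denominator contains the factor \<open>z\<close> and is not a unit; being
    nonzero suffices, since the numerator is an exact multiple of it.\<close>
  have "fps_nth ((2 - z)^2 * (1 - 2*z) * (1 - 3*z + z^2)) 0 \<noteq> 0"
    by (simp add: z_def power2_eq_square)
  then have "(2 - z)^2 * (1 - 2*z) * (1 - 3*z + z^2) \<noteq> 0"
    by (metis fps_zero_nth)
  moreover have "2 * z \<noteq> 0" by (simp add: z_def fps_X_neq_zero)
  ultimately have "2 * z * ((2 - z)^2 * (1 - 2*z) * (1 - 3*z + z^2)) \<noteq> 0"
    by (metis mult_eq_0_iff)
  then have nz: "2 * z * (2 - z)^2 * (1 - 2*z) * (1 - 3*z + z^2) \<noteq> 0"
    by (simp add: mult.assoc)
  have eq: "(1 + z * full_wt 1 0 0) * (2 * z * (2 - z)^2 * (1 - 2*z) * (1 - 3*z + z^2)) =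
    2 - 8*z + 2*z^2 + 17*z^3 - 15*z^4 + 4*z^5
      - (2 - 10*z + 16*z^2 - 9*z^3 + 2*z^4) * fps_sqrt (1 - 6*z + 5*z^2)"
    using full_wt_closed_form unfolding z_def sqrt_disc_def .
  show ?thesis
    using nonzero_mult_div_cancel_right[OF nz, of "1 + z * full_wt 1 0 0"]
    unfolding eq unfolding class_gf_eq z_def by (rule sym)
qed

end
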